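(* Assume the decomposable structure $f(x;\theta,u)=f_1(x;u)+f_2(\theta;u)+\langle\theta,c(x)\rangle$ and assume there is no noise on the observations, i.e. $y_t=x(\theta_{true};u_t)$ for all $t\in[T]$. For a family of loss functions $\{\ell_t\}_{t\in[T]}$ on $\Theta$ and a sequence $\{\theta_t\}_{t\in[T]}\subseteq\Theta$ write $R_T(\{\ell_t\},\{\theta_t\})=\sum_{t\in[T]}\ell_t(\theta_t)-\min_{\theta\in\Theta}\sum_{t\in[T]}\ell_t(\theta)$. Then for any sequence $\{\theta_t\}_{t\in[T]}\subseteq\Theta$: (a) $R_T(\{\ell^{sub}_t\},\{\theta_t\})\ge 0$, $R_T(\{\ell^{est}_t\},\{\theta_t\})\ge 0$, and $R_T(\{\ell^{pre}_t\},\{\theta_t\})\ge 0$; (b) $R_T(\{\ell^{sub}_t\},\{\theta_t\})+R_T(\{\ell^{est}_t\},\{\theta_t\})=\sum_{t=1}^T\ell^{sim}_t(\theta_t)$; (c) $R_T(\{\ell^{sim}_t\},\{\theta_t\})\ge R_T(\{\ell^{sub}_t\},\{\theta_t\})+R_T(\{\ell^{est}_t\},\{\theta_t\})$. As a consequence of (c), $R_T(\{\ell^{sim}_t\},\{\theta_t\})$ is an upper bound on both $R_T(\{\ell^{sub}_t\},\{\theta_t\})$ and $R_T(\{\ell^{est}_t\},\{\theta_t\})$.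
   Context: Let $T\ge 1$, $[T]=\{1,\dots,T\}$, let $\Theta\subseteq\mathbb{R}^p$ be a convex set with $\theta_{true}\in\Theta$, and let $\mathcal{X}\subseteq\mathbb{R}^n$. For a signal $u\in\mathbb{R}^k$ the feasible set of the agent is $\{x\in\mathcal{X}: g(x;u)\le 0\}$. For every $\theta\in\Theta$ and every signal $u$, the agent's problem is to minimize $f(x;\theta,u)$ over this feasible set; a minimizer is assumed to exist, and $x(\theta;u)$ denotes one fixed selected minimizer. Decomposable structure means $f(x;\theta,u)=f_1(x;u)+f_2(\theta;u)+\langle\theta,c(x)\rangle$ with $f_1,f_2$ real valued and $c(x)=(c_1(x),\dots,c_p(x))\in\mathbb{R}^p$; these functions of $x$ are defined on a set $D\subseteq\mathbb{R}^n$ containing $\mathcal{X}$ and the observations. Signals $u_1,\dots,u_T$ and observations $y_1,\dots,y_T\in D$ are given. For $\theta\in\Theta$, with $\|\cdot\|$ the Euclidean norm on $\mathbb{R}^n$, the losses are - prediction loss: $\ell^{pre}_t(\theta)=\|y_t-x(\theta;u_t)\|^2$; - suboptimality loss: $\ell^{sub}_t(\theta)=f(y_t;\theta,u_t)-f(x(\theta;u_t);\theta,u_t)$; - estimate loss: $\ell^{est}_t(\theta)=f(x(\theta;u_t);\theta_{true},u_t)-f(y_t;\theta_{true},u_t)$; - simple loss (depending on the given sequence $\{\theta_t\}$): $\ell^{sim}_t(\theta)=\langle\theta,c(y_t)-c(x(\theta_t;u_t))\rangle+\langle\theta_{true},c(x(\theta_t;u_t))-c(y_t)\rangle$. All minima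 written in the definition of the regret are assumed to exist. *)

theory Defs
  imports "HOL-Analysis.Analysis"
begin

(* The order on real^'m is componentwise, so this covers any finite number of
   scalar constraints. *)
definition feasible ::
  "(real^'n) set \<Rightarrow> (real^'n \<Rightarrow> real^'k \<Rightarrow> real^'m) \<Rightarrow> real^'k \<Rightarrow> (real^'n) set" where
  "feasible X g u = {x \<in> X. g x u \<le> 0}"

(* x \<theta> u is the selected minimizer. *)
definition minimizer_selection ::
  "(real^'p) set \<Rightarrow> (real^'n) set \<Rightarrow> (real^'n \<Rightarrow> real^'k \<Rightarrow> real^'m) \<Rightarrow>
   (real^'n \<Rightarrow> real^'p \<Rightarrow> real^'k \<Rightarrow> real) \<Rightarrow> (real^'p \<Rightarrow> real^'k \<Rightarrow> real^'n) \<Rightarrow> bool" where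
  "minimizer_selection \<Theta> X g f x \<longleftrightarrow>
     (\<forall>\<theta>\<in>\<Theta>. \<forall>u. is_arg_min (\<lambda>z. f z \<theta> u) (\<lambda>z. z \<in> feasible X g u) (x \<theta> u))"

definition decomposable ::
  "(real^'n) set \<Rightarrow> (real^'p) set \<Rightarrow> (real^'n \<Rightarrow> real^'p \<Rightarrow> real^'k \<Rightarrow> real) \<Rightarrow>
   (real^'n \<Rightarrow> real^'k \<Rightarrow> real) \<Rightarrow> (real^'p \<Rightarrow> real^'k \<Rightarrow> real) \<Rightarrow> (real^'n \<Rightarrow> real^'p) \<Rightarrow> bool" where
  "decomposable D \<Theta> f f1 f2 c \<longleftrightarrow>
     (\<forall>x\<in>D. \<forall>\<theta>\<in>\<Theta>. \<forall>u. f x \<theta> u = f1 x u + f2 \<theta> u + \<theta> \<bullet> c x)"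

definition prediction_loss ::
  "(real^'p \<Rightarrow> real^'k \<Rightarrow> real^'n) \<Rightarrow> (nat \<Rightarrow> real^'k) \<Rightarrow> (nat \<Rightarrow> real^'n) \<Rightarrow>
   nat \<Rightarrow> real^'p \<Rightarrow> real" where
  "prediction_loss x u y t \<theta> = (norm (y t - x \<theta> (u t)))\<^sup>2"

definition suboptimality_loss ::
  "(real^'n \<Rightarrow> real^'p \<Rightarrow> real^'k \<Rightarrow> real) \<Rightarrow> (real^'p \<Rightarrow> real^'k \<Rightarrow> real^'n) \<Rightarrow>
   (nat \<Rightarrow> real^'k) \<Rightarrow> (nat \<Rightarrow> real^'n) \<Rightarrow> nat \<Rightarrow> real^'p \<Rightarrow> real" where
  "suboptimality_loss f x u y t \<theta> = f (y t) \<theta> (u t) - f (x \<theta> (u t)) \<theta> (u t)"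

definition estimate_loss ::
  "(real^'n \<Rightarrow> real^'p \<Rightarrow> real^'k \<Rightarrow> real) \<Rightarrow> (real^'p \<Rightarrow> real^'k \<Rightarrow> real^'n) \<Rightarrow> real^'p \<Rightarrow>
   (nat \<Rightarrow> real^'k) \<Rightarrow> (nat \<Rightarrow> real^'n) \<Rightarrow> nat \<Rightarrow> real^'p \<Rightarrow> real" where
  "estimate_loss f x \<theta>true u y t \<theta> = f (x \<theta> (u t)) \<theta>true (u t) - f (y t) \<theta>true (u t)"

(* The agent's responses are taken along the given sequence \<theta>s, not at the argument
   \<theta>; the loss is therefore affine in \<theta>. *)
definition simple_loss ::
  "(real^'n \<Rightarrow> real^'p) \<Rightarrow> (real^'p \<Rightarrow> real^'k \<Rightarrow> real^'n) \<Rightarrow> real^'p \<Rightarrow>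
   (nat \<Rightarrow> real^'k) \<Rightarrow> (nat \<Rightarrow> real^'n) \<Rightarrow> (nat \<Rightarrow> real^'p) \<Rightarrow> nat \<Rightarrow> real^'p \<Rightarrow> real" where
  "simple_loss c x \<theta>true u y \<theta>s t \<theta> =
     \<theta> \<bullet> (c (y t) - c (x (\<theta>s t) (u t))) + \<theta>true \<bullet> (c (x (\<theta>s t) (u t)) - c (y t))"

definition total_loss :: "nat \<Rightarrow> (nat \<Rightarrow> 'a \<Rightarrow> real) \<Rightarrow> 'a \<Rightarrow> real" where
  "total_loss T L \<theta> = (\<Sum>t\<in>{1..T}. L t \<theta>)"

definition minimum_attained :: "'a set \<Rightarrow> ('a \<Rightarrow> real) \<Rightarrow> bool" where
  "minimum_attained S F \<longleftrightarrow> (\<exists>a. is_arg_min F (\<lambda>a. a \<in> S) a)"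

(* The least element of F ` S; unspecified unless minimum_attained S F. *)
definition minimum_value :: "'a set \<Rightarrow> ('a \<Rightarrow> real) \<Rightarrow> real" where
  "minimum_value S F = (LEAST v. v \<in> F ` S)"

definition regret :: "'a set \<Rightarrow> nat \<Rightarrow> (nat \<Rightarrow> 'a \<Rightarrow> real) \<Rightarrow> (nat \<Rightarrow> 'a) \<Rightarrow> real" where
  "regret \<Theta> T L \<theta>s = (\<Sum>t\<in>{1..T}. L t (\<theta>s t)) - minimum_value \<Theta> (total_loss T L)"

end

theory Submission
  imports Defs
begin

text \<open>
  Without noise the observation \<open>y t\<close> is itself the agent's response at the true
  parameter. Hence the suboptimality, estimate and prediction losses all vanish at
  \<open>\<theta>true\<close>, while they are nonnegative on \<open>\<Theta>\<close>: the first because \<open>x \<theta> (u t)\<close> beats the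
  feasible point \<open>y t\<close> under \<open>\<theta>\<close>, the second because \<open>y t\<close> beats the feasible point
  \<open>x \<theta> (u t)\<close> under \<open>\<theta>true\<close>, the third because it is a square. So the best total loss in
  hindsight is \<open>0\<close> for each of them, and each regret is just the accumulated loss
  (lemma \<open>regret_eq_sum_if_vanishes\<close>), which gives (a).

  In the sum of the suboptimality and estimate losses at one parameter, every response is
  evaluated once under \<open>\<theta>\<close> and once, with the opposite sign, under \<open>\<theta>true\<close>. The terms
  \<open>f1\<close> and \<open>f2\<close> therefore cancel and only the bilinear part survives, which is the simple
  loss at \<open>\<theta>s t\<close> (lemma \<open>suboptimality_plus_estimate_eq_simple\<close>); this is (b). Finally the
  simple loss also vanishes at \<open>\<theta>true\<close>, but it may be negative elsewhere, so its best total
  loss in hindsight is only known to be at most \<open>0\<close>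
  (lemma \<open>sum_le_regret_if_vanishes\<close>). This is why (c) is an inequality.
\<close>

lemma minimum_value_eqI:
  assumes "a \<in> S" and "\<And>b. b \<in> S \<Longrightarrow> F a \<le> F b"
  shows "minimum_value S F = F a"
  unfolding minimum_value_def using assms by (intro Least_equality) auto

lemma minimum_value_le:
  assumes "minimum_attained S F" and "b \<in> S"
  shows "minimum_value S F \<le> F b"
proof -
  obtain a where a: "a \<in> S" "\<And>b. b \<in> S \<Longrightarrow> F a \<le> F b"
    using assms(1) by (auto simp: minimum_attained_def is_arg_min_linorder)
  show ?thesis
    using minimum_value_eqI[of a S F] a assms(2) by simp
qed

lemma regret_eq_sum_if_vanishes:
  assumes "\<theta>0 \<in> \<Theta>" and zero: "\<And>t. t \<in> {1..T} \<Longrightarrow> L t \<theta>0 = 0"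
    and nonneg: "\<And>t \<theta>. t \<in> {1..T} \<Longrightarrow> \<theta> \<in> \<Theta> \<Longrightarrow> 0 \<le> L t \<theta>"
  shows "regret \<Theta> T L \<theta>s = (\<Sum>t\<in>{1..T}. L t (\<theta>s t))"
proof -
  have at_\<theta>0: "total_loss T L \<theta>0 = 0"
    unfolding total_loss_def using zero by (intro sum.neutral) blast
  have "0 \<le> total_loss T L \<theta>" if "\<theta> \<in> \<Theta>" for \<theta>
    unfolding total_loss_def using nonneg that by (intro sum_nonneg)
  then have "minimum_value \<Theta> (total_loss T L) = 0"
    using minimum_value_eqI[of \<theta>0 \<Theta> "total_loss T L"] assms(1) at_\<theta>0 by simp
  then show ?thesis
    by (simp add: regret_def)
qed

lemma sum_le_regret_if_vanishes:
  assumes "minimum_attained \<Theta> (total_loss T L)"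
    and "\<theta>0 \<in> \<Theta>" and zero: "\<And>t. t \<in> {1..T} \<Longrightarrow> L t \<theta>0 = 0"
  shows "(\<Sum>t\<in>{1..T}. L t (\<theta>s t)) \<le> regret \<Theta> T L \<theta>s"
proof -
  have "total_loss T L \<theta>0 = 0"
    unfolding total_loss_def using zero by (intro sum.neutral) blast
  then show ?thesis
    using minimum_value_le[OF assms(1,2)] by (simp add: regret_def)
qed

lemma minimizer_selection_feasible:
  assumes "minimizer_selection \<Theta> X g f x" and "\<theta> \<in> \<Theta>"
  shows "x \<theta> v \<in> feasible X g v"
  using assms by (auto simp: minimizer_selection_def is_arg_min_linorder)

lemma minimizer_selection_le:
  assumes "minimizer_selection \<Theta> X g f x" and "\<theta> \<in> \<Theta>" and "z \<in> feasible X g v"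
  shows "f (x \<theta> v) \<theta> v \<le> f z \<theta> v"
  using assms by (auto simp: minimizer_selection_def is_arg_min_linorder)

text \<open>
  Decomposability makes \<open>f y \<theta> v - f z \<theta> v\<close> equal to \<open>f1 y v - f1 z v + \<theta> \<bullet> (c y - c z)\<close>:
  taking the difference between two responses removes \<open>f2\<close>, and subtracting the same
  expression at \<open>\<theta>true\<close> removes \<open>f1\<close>. The simple loss enters at the argument
  \<open>\<theta>s t\<close> because its response is always the one at \<open>\<theta>s t\<close>, whereas the response in the
  other two losses moves with the argument.
\<close>

lemma suboptimality_plus_estimate_eq_simple:
  assumes "decomposable D \<Theta> f f1 f2 c" and "\<theta>s t \<in> \<Theta>" and "\<theta>true \<in> \<Theta>"
    and "y t \<in> D" and "x (\<theta>s t) (u t) \<in> D"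
  shows "suboptimality_loss f x u y t (\<theta>s t) + estimate_loss f x \<theta>true u y t (\<theta>s t)
    = simple_loss c x \<theta>true u y \<theta>s t (\<theta>s t)"
  using assms
  by (simp add: suboptimality_loss_def estimate_loss_def simple_loss_def decomposable_def
      inner_diff_right)

theorem proposition1:
  fixes T :: nat
    and \<Theta> :: "(real^'p) set" and \<theta>true :: "real^'p"
    and X D :: "(real^'n) set"
    and g :: "real^'n \<Rightarrow> real^'k \<Rightarrow> real^'m"
    and f :: "real^'n \<Rightarrow> real^'p \<Rightarrow> real^'k \<Rightarrow> real"
    and f1 :: "real^'n \<Rightarrow> real^'k \<Rightarrow> real"
    and f2 :: "real^'p \<Rightarrow> real^'k \<Rightarrow> real"
    and c :: "real^'n \<Rightarrow> real^'p"
    and x :: "real^'p \<Rightarrow> real^'k \<Rightarrow> real^'n"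
    and u :: "nat \<Rightarrow> real^'k" and y :: "nat \<Rightarrow> real^'n"
    and \<theta>s :: "nat \<Rightarrow> real^'p"
  defines "pre \<equiv> prediction_loss x u y"
    and "sub \<equiv> suboptimality_loss f x u y"
    and "est \<equiv> estimate_loss f x \<theta>true u y"
    and "sim \<equiv> simple_loss c x \<theta>true u y \<theta>s"
  assumes "T \<ge> 1"
    and "convex \<Theta>" and "\<theta>true \<in> \<Theta>"
    and "X \<subseteq> D" and "\<forall>t\<in>{1..T}. y t \<in> D"
    and "decomposable D \<Theta> f f1 f2 c"
    and "minimizer_selection \<Theta> X g f x"
    and noiseless: "\<forall>t\<in>{1..T}. y t = x \<theta>true (u t)"
    and "\<forall>t\<in>{1..T}. \<theta>s t \<in> \<Theta>"
    and "minimum_attained \<Theta> (total_loss T pre)"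
    and "minimum_attained \<Theta> (total_loss T sub)"
    and "minimum_attained \<Theta> (total_loss T est)"
    and "minimum_attained \<Theta> (total_loss T sim)"
  shows "(regret \<Theta> T sub \<theta>s \<ge> 0 \<and> regret \<Theta> T est \<theta>s \<ge> 0 \<and> regret \<Theta> T pre \<theta>s \<ge> 0)
    \<and> regret \<Theta> T sub \<theta>s + regret \<Theta> T est \<theta>s = (\<Sum>t=1..T. sim t (\<theta>s t))
    \<and> regret \<Theta> T sim \<theta>s \<ge> regret \<Theta> T sub \<theta>s + regret \<Theta> T est \<theta>s
    \<and> (regret \<Theta> T sim \<theta>s \<ge> regret \<Theta> T sub \<theta>s \<and> regret \<Theta> T sim \<theta>s \<ge> regret \<Theta> T est \<theta>s)"
proof -
  note true = \<open>\<theta>true \<in> \<Theta>\<close> and sel = \<open>minimizer_selection \<Theta> X g f x\<close>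
  have y_feasible: "y t \<in> feasible X g (u t)" if "t \<in> {1..T}" for t
    using minimizer_selection_feasible[OF sel true] noiseless that by simp
  have sub: "regret \<Theta> T sub \<theta>s = (\<Sum>t\<in>{1..T}. sub t (\<theta>s t))"
  and sub_nonneg: "\<And>t \<theta>. t \<in> {1..T} \<Longrightarrow> \<theta> \<in> \<Theta> \<Longrightarrow> 0 \<le> sub t \<theta>"
  proof -
    show nonneg: "0 \<le> sub t \<theta>" if "t \<in> {1..T}" "\<theta> \<in> \<Theta>" for t \<theta>
      using minimizer_selection_le[OF sel that(2) y_feasible[OF that(1)]]
      by (simp add: sub_def suboptimality_loss_def)
    show "regret \<Theta> T sub \<theta>s = (\<Sum>t\<in>{1..T}. sub t (\<theta>s t))"
      using noiseless nonneg
      by (intro regret_eq_sum_if_vanishes[OF true]) (simp_all add: sub_def suboptimality_loss_def)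
  qed
  have est: "regret \<Theta> T est \<theta>s = (\<Sum>t\<in>{1..T}. est t (\<theta>s t))"
  and est_nonneg: "\<And>t \<theta>. t \<in> {1..T} \<Longrightarrow> \<theta> \<in> \<Theta> \<Longrightarrow> 0 \<le> est t \<theta>"
  proof -
    show nonneg: "0 \<le> est t \<theta>" if "t \<in> {1..T}" "\<theta> \<in> \<Theta>" for t \<theta>
      using minimizer_selection_le[OF sel true minimizer_selection_feasible[OF sel that(2)]]
        noiseless that(1)
      by (simp add: est_def estimate_loss_def)
    show "regret \<Theta> T est \<theta>s = (\<Sum>t\<in>{1..T}. est t (\<theta>s t))"
      using noiseless nonneg
      by (intro regret_eq_sum_if_vanishes[OF true]) (simp_all add: est_def estimate_loss_def)
  qed
  have pre: "regret \<Theta> T pre \<theta>s = (\<Sum>t\<in>{1..T}. pre t (\<theta>s t))"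
    using noiseless
    by (intro regret_eq_sum_if_vanishes[OF true]) (simp_all add: pre_def prediction_loss_def)

  have sub_regret_nonneg: "0 \<le> regret \<Theta> T sub \<theta>s"
    unfolding sub using sub_nonneg \<open>\<forall>t\<in>{1..T}. \<theta>s t \<in> \<Theta>\<close> by (intro sum_nonneg) blast
  have est_regret_nonneg: "0 \<le> regret \<Theta> T est \<theta>s"
    unfolding est using est_nonneg \<open>\<forall>t\<in>{1..T}. \<theta>s t \<in> \<Theta>\<close> by (intro sum_nonneg) blast
  have pre_regret_nonneg: "0 \<le> regret \<Theta> T pre \<theta>s"
    unfolding pre by (intro sum_nonneg) (simp add: pre_def prediction_loss_def)

  have "sub t (\<theta>s t) + est t (\<theta>s t) = sim t (\<theta>s t)" if t: "t \<in> {1..T}" for t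
  proof -
    have \<theta>s: "\<theta>s t \<in> \<Theta>" and y: "y t \<in> D"
      using \<open>\<forall>t\<in>{1..T}. \<theta>s t \<in> \<Theta>\<close> \<open>\<forall>t\<in>{1..T}. y t \<in> D\<close> t by auto
    have "x (\<theta>s t) (u t) \<in> D"
      using minimizer_selection_feasible[OF sel \<theta>s, of "u t"] \<open>X \<subseteq> D\<close>
      by (auto simp: feasible_def)
    then show ?thesis
      unfolding sub_def est_def sim_def
      using \<open>decomposable D \<Theta> f f1 f2 c\<close> \<theta>s true y
      by (intro suboptimality_plus_estimate_eq_simple)
  qed
  then have sum_eq: "regret \<Theta> T sub \<theta>s + regret \<Theta> T est \<theta>s = (\<Sum>t=1..T. sim t (\<theta>s t))"
    unfolding sub est sum.distrib[symmetric] by (rule sum.cong[OF refl])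

  have "(\<Sum>t=1..T. sim t (\<theta>s t)) \<le> regret \<Theta> T sim \<theta>s"
    using \<open>minimum_attained \<Theta> (total_loss T sim)\<close> true
    by (rule sum_le_regret_if_vanishes) (simp add: sim_def simple_loss_def inner_diff_right)
  with sum_eq sub_regret_nonneg est_regret_nonneg pre_regret_nonneg show ?thesis
    by linarith
qed

end
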